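(* Let $F>0$, let $N\ge 1$ be an integer and $\epsilon=1/N$. Suppose that $$\phi''_{F}>0,\ \phi''_{2F}<0,\quad \rho'_{F}\le 0,\ \rho'_{2F}\le 0,\quad \rho''_{F}\ge 0,\ \rho''_{2F}\ge 0,\quad G''_{F}\ge 0.$$ Then the uniform deformation $\mathbf{y}_F$ is stable in the reconstruction-based local model, i.e. $\langle\delta^2\mathcal{E}^{c,r}(\mathbf{y}_F)\mathbf{u},\mathbf{u}\rangle>0$ for all $\mathbf{u}\in\mathcal{U}\setminus\{\mathbf{0}\}$, if and only if $$2G'_F(\rho''_F+4\rho''_{2F})+\phi''_F+4\phi''_{2F}>0.$$
   Context: Fix smooth functions $\phi,\rho:(0,\infty)\to\mathbb{R}$ (pair potential, electron density) and $G:\mathbb{R}\to\mathbb{R}$ (embedding function), $F>0$, an integer $N\ge1$, and $\epsilon=1/N$. Let $\mathcal{U}$ be the space of real sequences $\mathbf{u}=(u_\ell)_{\ell\in\mathbb{Z}}$ with $u_{\ell+2N}=u_\ell$ and $\sum_{\ell=-N+1}^N u_\ell=0$. Let $(\mathbf{y}_F)_\ell=F\epsilon\ell$ and $\mathcal{Y}_F=\{\mathbf{y}_F+\mathbf{u}:\mathbf{u}\in\mathcal{U}\}$. For a sequence $\mathbf{y}$ put $y'_\ell=(y_\ell-y_{\ell-1})/\epsilon$. Reconstruction-based local (Cauchy--Born) EAM energy: for $\mathbf{y}\in\mathcal{Y}_F$ (near $\mathbf{y}_F$), $$\mathcal{E}^{c,r}(\mathbf{y})=\epsilon\sum_{\ell=-N+1}^N\Big\{G\big(\rho(y'_\ell)+\rho(2y'_\ell)+\rho(y'_{\ell+1})+\rho(2y'_{\ell+1})\big)+\tfrac12\big[\phi(y'_\ell)+\phi(2y'_\ell)+\phi(y'_{\ell+1})+\phi(2y'_{\ell+1})\big]\Big\}.$$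 The second variation is the quadratic form $\langle\delta^2\mathcal{E}^{c,r}(\mathbf{y}_F)\mathbf{u},\mathbf{u}\rangle=\frac{d^2}{dt^2}\mathcal{E}^{c,r}(\mathbf{y}_F+t\mathbf{u})\big|_{t=0}$ for $\mathbf{u}\in\mathcal{U}$. Notation: $\phi''_F=\phi''(F)$, $\phi''_{2F}=\phi''(2F)$, $\rho'_F=\rho'(F)$, $\rho'_{2F}=\rho'(2F)$, $\rho''_F=\rho''(F)$, $\rho''_{2F}=\rho''(2F)$, and $G'_F=G'(\bar\rho_F)$, $G''_F=G''(\bar\rho_F)$ with $\bar\rho_F=2\rho(F)+2\rho(2F)$. *)

theory Defs
  imports "HOL-Analysis.Analysis"
begin

(* Only meaningful for open S. Real functions on an open set such as (0,\<infinity>) are represented by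
   total functions; the values outside the set do not influence derivatives at points of the set. *)
definition smooth_on :: "real set \<Rightarrow> (real \<Rightarrow> real) \<Rightarrow> bool" where
  "smooth_on S f \<longleftrightarrow> (\<forall>k. \<forall>x\<in>S. (deriv ^^ k) f differentiable (at x))"

definition mesh :: "nat \<Rightarrow> real" where
  "mesh N = 1 / real N"

definition displacements :: "nat \<Rightarrow> (int \<Rightarrow> real) set" where
  "displacements N =
     {u. (\<forall>l. u (l + 2 * int N) = u l) \<and> (\<Sum>l = - int N + 1..int N. u l) = 0}"

definition uniform_deformation :: "nat \<Rightarrow> real \<Rightarrow> int \<Rightarrow> real" where
  "uniform_deformation N F l = F * mesh N * of_int l"

definition strain :: "nat \<Rightarrow> (int \<Rightarrow> real) \<Rightarrow> int \<Rightarrow> real" where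
  "strain N y l = (y l - y (l - 1)) / mesh N"

(* Meaningful for deformations y with positive strains, in particular close to the uniform
   deformation with F > 0; elsewhere phi and rho are evaluated outside (0,\<infinity>). *)
definition energy_cr ::
  "(real \<Rightarrow> real) \<Rightarrow> (real \<Rightarrow> real) \<Rightarrow> (real \<Rightarrow> real) \<Rightarrow> nat \<Rightarrow> (int \<Rightarrow> real) \<Rightarrow> real" where
  "energy_cr \<phi> \<rho> G N y =
     mesh N * (\<Sum>l = - int N + 1..int N.
       G (\<rho> (strain N y l) + \<rho> (2 * strain N y l)
            + \<rho> (strain N y (l + 1)) + \<rho> (2 * strain N y (l + 1)))
       + 1/2 * (\<phi> (strain N y l) + \<phi> (2 * strain N y l)
            + \<phi> (strain N y (l + 1)) + \<phi> (2 * strain N y (l + 1))))"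

definition second_variation ::
  "((int \<Rightarrow> real) \<Rightarrow> real) \<Rightarrow> (int \<Rightarrow> real) \<Rightarrow> (int \<Rightarrow> real) \<Rightarrow> real" where
  "second_variation E y u = (deriv ^^ 2) (\<lambda>t. E (\<lambda>l. y l + t * u l)) 0"

definition stable_cr ::
  "(real \<Rightarrow> real) \<Rightarrow> (real \<Rightarrow> real) \<Rightarrow> (real \<Rightarrow> real) \<Rightarrow> nat \<Rightarrow> real \<Rightarrow> bool" where
  "stable_cr \<phi> \<rho> G N F \<longleftrightarrow>
     (\<forall>u \<in> displacements N - {\<lambda>_. 0}.
        second_variation (energy_cr \<phi> \<rho> G N) (uniform_deformation N F) u > 0)"

definition rho_bar :: "(real \<Rightarrow> real) \<Rightarrow> real \<Rightarrow> real" where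
  "rho_bar \<rho> F = 2 * \<rho> F + 2 * \<rho> (2 * F)"

end

theory Submission
  imports Defs
begin

(* With v the strain of u and A the quantity in the criterion, the second variation is
   eps * sum_l (G''_F (rho'_F + 2 rho'_2F)^2 (v_l + v_(l+1))^2 + A v_l^2).
   If A > 0 this is positive unless v = 0, that is, unless u is constant, hence zero. Conversely,
   the first term vanishes on the alternating displacement u_l = (-1)^l, whose strain satisfies
   v_l + v_(l+1) = 0; so stability forces A > 0. *)

section \<open>Calculus of second derivatives at a point\<close>

text \<open>A relation with explicit values lets second derivatives be assembled by sum and chain
  rules. \<open>f'\<close> must be the derivative of \<open>f\<close> on a neighbourhood of
  \<open>x\<close>, since that is what identifies \<open>d2\<close> with the iterated
  \<open>deriv\<close>; a neighbourhood suits \<open>\<phi>\<close> and \<open>\<rho>\<close>, which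
  are smooth only on the positive axis.\<close>

definition has_two_derivs :: "(real \<Rightarrow> real) \<Rightarrow> real \<Rightarrow> real \<Rightarrow> real \<Rightarrow> bool" where
  "has_two_derivs f d1 d2 x \<longleftrightarrow>
     (\<exists>f'. (\<forall>\<^sub>F t in nhds x. (f has_real_derivative f' t) (at t)) \<and> f' x = d1 \<and>
       (f' has_real_derivative d2) (at x))"

lemma has_two_derivsI:
  assumes "\<forall>\<^sub>F t in nhds x. (f has_real_derivative f' t) (at t)"
    and "f' x = d1" and "(f' has_real_derivative d2) (at x)"
  shows "has_two_derivs f d1 d2 x"
  using assms unfolding has_two_derivs_def by blast

lemma has_two_derivsE:
  assumes "has_two_derivs f d1 d2 x"
  obtains f' where "\<forall>\<^sub>F t in nhds x. (f has_real_derivative f' t) (at t)"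
    and "f' x = d1" and "(f' has_real_derivative d2) (at x)"
  using assms unfolding has_two_derivs_def by blast

lemma has_two_derivs_imp_deriv2:
  assumes "has_two_derivs f d1 d2 x"
  shows "(deriv ^^ 2) f x = d2"
proof -
  obtain f' where f': "\<forall>\<^sub>F t in nhds x. (f has_real_derivative f' t) (at t)"
    and d2: "(f' has_real_derivative d2) (at x)"
    using assms by (rule has_two_derivsE)
  have "\<forall>\<^sub>F t in nhds x. deriv f t = f' t"
    using f' by eventually_elim (rule DERIV_imp_deriv)
  then have "deriv (deriv f) x = deriv f' x"
    by (rule deriv_cong_ev) simp
  also have "\<dots> = d2"
    using d2 by (rule DERIV_imp_deriv)
  finally show ?thesis
    by (simp add: numeral_2_eq_2)
qed

lemma has_two_derivs_affine: "has_two_derivs (\<lambda>t. a + t * b) b 0 x"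
  by (rule has_two_derivsI[where f' = "\<lambda>_. b"])
     (auto intro!: always_eventually derivative_eq_intros)

lemma has_two_derivs_add:
  assumes "has_two_derivs f d1 d2 x" and "has_two_derivs g e1 e2 x"
  shows "has_two_derivs (\<lambda>t. f t + g t) (d1 + e1) (d2 + e2) x"
proof -
  obtain f' where f': "\<forall>\<^sub>F t in nhds x. (f has_real_derivative f' t) (at t)" "f' x = d1"
      "(f' has_real_derivative d2) (at x)"
    using assms(1) by (rule has_two_derivsE)
  obtain g' where g': "\<forall>\<^sub>F t in nhds x. (g has_real_derivative g' t) (at t)" "g' x = e1"
      "(g' has_real_derivative e2) (at x)"
    using assms(2) by (rule has_two_derivsE)
  show ?thesis
  proof (rule has_two_derivsI[where f' = "\<lambda>t. f' t + g' t"])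
    show "\<forall>\<^sub>F t in nhds x. ((\<lambda>t. f t + g t) has_real_derivative f' t + g' t) (at t)"
      using f'(1) g'(1) by eventually_elim (rule DERIV_add)
  qed (use f' g' in \<open>auto intro: DERIV_add\<close>)
qed

lemma has_two_derivs_cmult:
  assumes "has_two_derivs f d1 d2 x"
  shows "has_two_derivs (\<lambda>t. c * f t) (c * d1) (c * d2) x"
proof -
  obtain f' where f': "\<forall>\<^sub>F t in nhds x. (f has_real_derivative f' t) (at t)" "f' x = d1"
      "(f' has_real_derivative d2) (at x)"
    using assms by (rule has_two_derivsE)
  show ?thesis
  proof (rule has_two_derivsI[where f' = "\<lambda>t. c * f' t"])
    show "\<forall>\<^sub>F t in nhds x. ((\<lambda>t. c * f t) has_real_derivative c * f' t) (at t)"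
      using f'(1) by eventually_elim (rule DERIV_cmult)
  qed (use f' in \<open>auto intro: DERIV_cmult\<close>)
qed

lemma has_two_derivs_sum:
  assumes "\<And>i. i \<in> I \<Longrightarrow> has_two_derivs (f i) (d1 i) (d2 i) x"
  shows "has_two_derivs (\<lambda>t. \<Sum>i\<in>I. f i t) (\<Sum>i\<in>I. d1 i) (\<Sum>i\<in>I. d2 i) x"
  using assms
proof (induction I rule: infinite_finite_induct)
  case (insert i I)
  then show ?case
    by (simp add: has_two_derivs_add)
qed (use has_two_derivs_affine[of 0 0] in simp_all)

text \<open>The chain rule holds near \<open>x\<close>, and its result
  \<open>g' (f t) * f' t\<close> is differentiated at \<open>x\<close> by the product rule.\<close>

lemma has_two_derivs_compose:
  assumes g: "has_two_derivs g e1 e2 (f x)" and f: "has_two_derivs f d1 d2 x"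
  shows "has_two_derivs (\<lambda>t. g (f t)) (e1 * d1) (e2 * d1\<^sup>2 + e1 * d2) x"
proof -
  obtain f' where f': "\<forall>\<^sub>F t in nhds x. (f has_real_derivative f' t) (at t)" "f' x = d1"
      "(f' has_real_derivative d2) (at x)"
    using f by (rule has_two_derivsE)
  obtain g' where g': "\<forall>\<^sub>F s in nhds (f x). (g has_real_derivative g' s) (at s)" "g' (f x) = e1"
      "(g' has_real_derivative e2) (at (f x))"
    using g by (rule has_two_derivsE)
  have fx: "(f has_real_derivative d1) (at x)"
    using eventually_nhds_x_imp_x[OF f'(1)] f'(2) by simp
  \<comment> \<open>Continuity of \<open>f\<close> pulls the neighbourhood of \<open>f x\<close> on
    which \<open>g'\<close> is the derivative of \<open>g\<close> back to a neighbourhood of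
    \<open>x\<close>.\<close>
  then have "filterlim f (nhds (f x)) (nhds x)"
    using DERIV_isCont isCont_def tendsto_at_iff_tendsto_nhds by blast
  with g'(1) have "\<forall>\<^sub>F t in nhds x. (g has_real_derivative g' (f t)) (at (f t))"
    by (rule eventually_compose_filterlim)
  with f'(1) have "\<forall>\<^sub>F t in nhds x. ((\<lambda>t. g (f t)) has_real_derivative g' (f t) * f' t) (at t)"
    by eventually_elim (rule DERIV_chain2)
  moreover have "((\<lambda>t. g' (f t) * f' t) has_real_derivative e2 * d1\<^sup>2 + e1 * d2) (at x)"
    using DERIV_mult[OF DERIV_chain2[OF g'(3) fx] f'(3)] f'(2) g'(2)
    by (simp add: power2_eq_square algebra_simps)
  ultimately show ?thesis
    using f'(2) g'(2) by (intro has_two_derivsI[where f' = "\<lambda>t. g' (f t) * f' t"]) auto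
qed

lemma smooth_on_has_two_derivs:
  assumes "smooth_on S f" and "open S" and "x \<in> S"
  shows "has_two_derivs f (deriv f x) ((deriv ^^ 2) f x) x"
proof (rule has_two_derivsI[where f' = "deriv f"])
  have D: "((deriv ^^ k) f has_real_derivative deriv ((deriv ^^ k) f) y) (at y)" if "y \<in> S" for k y
    using assms(1) that
    by (metis DERIV_deriv_iff_real_differentiable smooth_on_def)
  show "\<forall>\<^sub>F t in nhds x. (f has_real_derivative deriv f t) (at t)"
    using eventually_nhds_in_open[OF assms(2,3)]
    by eventually_elim (use D[of _ 0] in simp)
  show "(deriv f has_real_derivative (deriv ^^ 2) f x) (at x)"
    using D[OF assms(3), of 1] by (simp add: numeral_2_eq_2)
qed simp

section \<open>Periodic sequences and their strains\<close>

text \<open>Shifting the window by one site drops -N + 1 and gains N + 1; these sites are one period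
  apart, so \<open>w\<close> agrees there.\<close>

lemma sum_shift_period:
  fixes w :: "int \<Rightarrow> real"
  assumes "\<And>l. w (l + 2 * int N) = w l" and "N \<ge> 1"
  shows "(\<Sum>l = - int N + 1..int N. w (l + 1)) = (\<Sum>l = - int N + 1..int N. w l)"
proof -
  have "(\<Sum>l = - int N + 1..int N. w (l + 1)) = (\<Sum>l = - int N + 2..int N + 1. w l)"
    by (rule sum.reindex_bij_witness[of _ "\<lambda>l. l - 1" "\<lambda>l. l + 1"]) auto
  also have "{- int N + 2..int N + 1} = insert (int N + 1) {- int N + 2..int N}"
    using assms(2) by auto
  also have "sum w \<dots> = w (int N + 1) + sum w {- int N + 2..int N}"
    by simp
  also have "w (int N + 1) = w (- int N + 1)"
    using assms(1)[of "- int N + 1"] by (simp add: algebra_simps)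
  also have "w (- int N + 1) + sum w {- int N + 2..int N}
      = sum w (insert (- int N + 1) {- int N + 2..int N})"
    by simp
  also have "insert (- int N + 1) {- int N + 2..int N} = {- int N + 1..int N}"
    using assms(2) by auto
  finally show ?thesis .
qed

lemma periodic_add_int_mult:
  fixes u :: "int \<Rightarrow> 'a" and p :: int
  assumes "\<And>l. u (l + p) = u l"
  shows "u (l + p * k) = u l"
proof (induction k rule: int_induct[of _ 0])
  case (step1 k)
  then show ?case
    using assms[of "l + p * k"] by (simp add: algebra_simps)
next
  case (step2 k)
  then show ?case
    using assms[of "l + p * (k - 1)"] by (simp add: algebra_simps)
qed simp

lemma strain_periodic:
  assumes "\<And>l. u (l + 2 * int N) = u l"
  shows "strain N u (l + 2 * int N) = strain N u l"
  using assms[of l] assms[of "l - 1"] by (simp add: strain_def algebra_simps)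

text \<open>Vanishing strain makes \<open>u\<close> constant over one period, zero mean makes the
  constant zero, and periodicity carries this to all sites.\<close>

lemma displacements_strain_zero:
  assumes u: "u \<in> displacements N" and N: "N \<ge> 1"
    and v: "\<And>l. l \<in> {- int N + 1..int N} \<Longrightarrow> strain N u l = 0"
  shows "u = (\<lambda>_. 0)"
proof -
  have per: "u (l + 2 * int N) = u l" for l
    using u by (simp add: displacements_def)
  have step: "u l = u (l - 1)" if "l \<in> {- int N + 1..int N}" for l
    using v[OF that] N by (simp add: strain_def mesh_def)
  \<comment> \<open>The induction starts at -N, not -N + 1, because the strain at -N + 1 compares
    with site -N. The upper bound sits inside the claim since the induction itself has none.\<close>
  have const: "l \<le> int N \<longrightarrow> u l = u (- int N)" if "- int N \<le> l" for l
    using that by (induction l rule: int_ge_induct) (use step in force)+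
  have "(\<Sum>l = - int N + 1..int N. u l) = (\<Sum>l = - int N + 1..int N. u (- int N))"
    by (rule sum.cong) (auto intro: const[rule_format])
  with u N have 0: "u (- int N) = 0"
    by (simp add: displacements_def)
  show ?thesis
  proof
    fix l
    \<comment> \<open>\<open>?r - int N\<close> is the representative of \<open>l\<close> modulo the
      period in -N..N - 1, where \<open>const\<close> applies.\<close>
    let ?r = "(l + int N) mod (2 * int N)"
    have "0 \<le> ?r" "?r < 2 * int N"
      using N by simp_all
    then have "u (?r - int N) = 0"
      using const[of "?r - int N"] 0 by simp
    moreover have "l = ?r - int N + 2 * int N * ((l + int N) div (2 * int N))"
      using mod_mult_div_eq[of "l + int N" "2 * int N"] by linarith
    ultimately show "u l = 0"
      using periodic_add_int_mult[of u, OF per] by metis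
  qed
qed

section \<open>Second variation at the uniform deformation\<close>

text \<open>Along the line through the uniform deformation every strain is affine in
  \<open>t\<close>, so the energy is a sum of compositions with affine functions.\<close>

lemma strain_uniform_add:
  assumes "N \<ge> 1"
  shows "strain N (\<lambda>l. uniform_deformation N F l + t * u l) l = F + t * strain N u l"
  using assms by (simp add: strain_def uniform_deformation_def mesh_def field_simps)

text \<open>Differentiating site by site, the \<open>G''\<close> part gives the square of the first
  derivative of the density, hence (v_l + v_(l+1))^2; the \<open>G'\<close> and
  \<open>\<phi>\<close> parts give v_l^2 + v_(l+1)^2, and summing over a period merges the two
  squares.\<close>

lemma second_variation_energy_cr:
  assumes \<phi>: "smooth_on {0<..} \<phi>" and \<rho>: "smooth_on {0<..} \<rho>" and G: "smooth_on UNIV G"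
    and F: "F > 0" and N: "N \<ge> 1" and u: "\<And>l. u (l + 2 * int N) = u l"
  shows "second_variation (energy_cr \<phi> \<rho> G N) (uniform_deformation N F) u =
    mesh N * (\<Sum>l = - int N + 1..int N.
      (deriv ^^ 2) G (rho_bar \<rho> F) * (deriv \<rho> F + 2 * deriv \<rho> (2 * F))\<^sup>2
        * (strain N u l + strain N u (l + 1))\<^sup>2
      + (2 * deriv G (rho_bar \<rho> F) * ((deriv ^^ 2) \<rho> F + 4 * (deriv ^^ 2) \<rho> (2 * F))
        + (deriv ^^ 2) \<phi> F + 4 * (deriv ^^ 2) \<phi> (2 * F)) * (strain N u l)\<^sup>2)"
    (is "_ = mesh N * (\<Sum>l = _.._. ?g * (deriv \<rho> F + _)\<^sup>2 * _ + ?A * _)")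
proof -
  define v where "v = strain N u"
  \<comment> \<open>Half of \<open>?A\<close>: each squared strain occurs at two neighbouring sites,
    with weight \<open>B\<close> each time.\<close>
  define B where "B = deriv G (rho_bar \<rho> F) * ((deriv ^^ 2) \<rho> F + 4 * (deriv ^^ 2) \<rho> (2 * F))
    + 1/2 * ((deriv ^^ 2) \<phi> F + 4 * (deriv ^^ 2) \<phi> (2 * F))"
  define c where "c = ?g * (deriv \<rho> F + 2 * deriv \<rho> (2 * F))\<^sup>2"
  \<comment> \<open>The doubled argument has slope \<open>2 * a\<close>, whence the factors 2 and
    4.\<close>
  have pair: "has_two_derivs (\<lambda>t. f (F + t * a) + f (2 * (F + t * a)))
      ((deriv f F + 2 * deriv f (2 * F)) * a)
      (((deriv ^^ 2) f F + 4 * (deriv ^^ 2) f (2 * F)) * a\<^sup>2) 0"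
    if f: "smooth_on {0<..} f" for f a
  proof -
    \<comment> \<open>The point is written \<open>F + 0 * a\<close> to match the inner affine
      function evaluated at 0 in the chain rule.\<close>
    have "has_two_derivs f (deriv f F) ((deriv ^^ 2) f F) (F + 0 * a)"
      using smooth_on_has_two_derivs[OF f] F by simp
    note 1 = has_two_derivs_compose[where f = "\<lambda>t. F + t * a", OF this has_two_derivs_affine]
    have "has_two_derivs f (deriv f (2 * F)) ((deriv ^^ 2) f (2 * F)) (2 * (F + 0 * a))"
      using smooth_on_has_two_derivs[OF f] F by simp
    note 2 = has_two_derivs_compose[where f = "\<lambda>t. 2 * (F + t * a)",
        OF this has_two_derivs_cmult[OF has_two_derivs_affine]]
    from has_two_derivs_add[OF 1 2] show ?thesis
      by (simp add: algebra_simps)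
  qed
  have quad: "has_two_derivs (\<lambda>t. f (F + t * a) + f (2 * (F + t * a))
        + f (F + t * b) + f (2 * (F + t * b)))
      ((deriv f F + 2 * deriv f (2 * F)) * (a + b))
      (((deriv ^^ 2) f F + 4 * (deriv ^^ 2) f (2 * F)) * (a\<^sup>2 + b\<^sup>2)) 0"
    if f: "smooth_on {0<..} f" for f a b
    using has_two_derivs_add[OF pair[OF f, of a] pair[OF f, of b]]
    by (simp add: add.assoc distrib_left)
  have site: "has_two_derivs (\<lambda>t.
      G (\<rho> (F + t * a) + \<rho> (2 * (F + t * a)) + \<rho> (F + t * b) + \<rho> (2 * (F + t * b)))
      + 1/2 * (\<phi> (F + t * a) + \<phi> (2 * (F + t * a)) + \<phi> (F + t * b) + \<phi> (2 * (F + t * b))))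
      (deriv G (rho_bar \<rho> F) * ((deriv \<rho> F + 2 * deriv \<rho> (2 * F)) * (a + b))
        + 1/2 * ((deriv \<phi> F + 2 * deriv \<phi> (2 * F)) * (a + b)))
      (c * (a + b)\<^sup>2 + B * (a\<^sup>2 + b\<^sup>2)) 0" for a b
  proof -
    have "has_two_derivs G (deriv G (rho_bar \<rho> F)) ?g
        (\<rho> (F + 0 * a) + \<rho> (2 * (F + 0 * a)) + \<rho> (F + 0 * b) + \<rho> (2 * (F + 0 * b)))"
      using smooth_on_has_two_derivs[OF G, of "rho_bar \<rho> F"] by (simp add: rho_bar_def add.commute)
    note 1 = has_two_derivs_compose[where f = "\<lambda>t. \<rho> (F + t * a) + \<rho> (2 * (F + t * a))
        + \<rho> (F + t * b) + \<rho> (2 * (F + t * b))", OF this quad[OF \<rho>]]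
    have "?g * ((deriv \<rho> F + 2 * deriv \<rho> (2 * F)) * (a + b))\<^sup>2
        + deriv G (rho_bar \<rho> F) * (((deriv ^^ 2) \<rho> F + 4 * (deriv ^^ 2) \<rho> (2 * F)) * (a\<^sup>2 + b\<^sup>2))
        + 1/2 * (((deriv ^^ 2) \<phi> F + 4 * (deriv ^^ 2) \<phi> (2 * F)) * (a\<^sup>2 + b\<^sup>2))
      = c * (a + b)\<^sup>2 + B * (a\<^sup>2 + b\<^sup>2)"
      unfolding B_def c_def power_mult_distrib by (simp only: distrib_right mult.assoc add.assoc)
    with has_two_derivs_add[OF 1 has_two_derivs_cmult[OF quad[OF \<phi>, of a b], of "1/2"]]
    show ?thesis
      by (simp only:)
  qed
  \<comment> \<open>Strains inherit the period of \<open>u\<close>, so their squares can be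
    shifted.\<close>
  have shift: "(\<Sum>l = - int N + 1..int N. (v (l + 1))\<^sup>2) = (\<Sum>l = - int N + 1..int N. (v l)\<^sup>2)"
    unfolding v_def using sum_shift_period[of "\<lambda>l. (strain N u l)\<^sup>2", OF _ N] strain_periodic[of u, OF u]
    by simp
  have "second_variation (energy_cr \<phi> \<rho> G N) (uniform_deformation N F) u =
    mesh N * (\<Sum>l = - int N + 1..int N. c * (v l + v (l + 1))\<^sup>2 + B * ((v l)\<^sup>2 + (v (l + 1))\<^sup>2))"
    unfolding second_variation_def energy_cr_def strain_uniform_add[OF N] v_def
    by (rule has_two_derivs_imp_deriv2[OF has_two_derivs_cmult[OF has_two_derivs_sum]]) (rule site)
  also have "\<dots> = mesh N * (\<Sum>l = - int N + 1..int N. c * (v l + v (l + 1))\<^sup>2 + 2 * B * (v l)\<^sup>2)"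
    using shift by (simp add: sum.distrib distrib_left flip: sum_distrib_left)
  also have "2 * B = ?A"
    by (simp add: B_def algebra_simps)
  finally show ?thesis
    unfolding c_def v_def .
qed

section \<open>The alternating displacement and the stability criterion\<close>

definition alternating :: "int \<Rightarrow> real" where
  "alternating l = (if even l then 1 else - 1)"

lemma alternating_Suc: "alternating (l + 1) = - alternating l"
  by (simp add: alternating_def)

text \<open>The period is even, so parity survives it. A shift by one preserves the sum over a
  period but flips every sign, so the sum is its own negative.\<close>

lemma alternating_displacements:
  assumes "N \<ge> 1"
  shows "alternating \<in> displacements N"
proof -
  have per: "alternating (l + 2 * int N) = alternating l" for l
    by (simp add: alternating_def)
  with sum_shift_period[of alternating, OF _ assms] show ?thesis
    by (simp add: displacements_def alternating_Suc sum_negf)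
qed

lemma strain_alternating_Suc:
  "strain N alternating (l + 1) = - strain N alternating l"
  by (simp add: strain_def alternating_def diff_divide_distrib)

theorem theorem4p4:
  fixes \<phi> \<rho> G :: "real \<Rightarrow> real" and F :: real and N :: nat
  assumes "smooth_on {0<..} \<phi>" and "smooth_on {0<..} \<rho>" and "smooth_on UNIV G"
    and "F > 0" and "N \<ge> 1"
    and "(deriv ^^ 2) \<phi> F > 0" and "(deriv ^^ 2) \<phi> (2 * F) < 0"
    and "deriv \<rho> F \<le> 0" and "deriv \<rho> (2 * F) \<le> 0"
    and "(deriv ^^ 2) \<rho> F \<ge> 0" and "(deriv ^^ 2) \<rho> (2 * F) \<ge> 0"
    and "(deriv ^^ 2) G (rho_bar \<rho> F) \<ge> 0"
  shows "stable_cr \<phi> \<rho> G N F \<longleftrightarrow>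
    2 * deriv G (rho_bar \<rho> F) * ((deriv ^^ 2) \<rho> F + 4 * (deriv ^^ 2) \<rho> (2 * F))
      + (deriv ^^ 2) \<phi> F + 4 * (deriv ^^ 2) \<phi> (2 * F) > 0"
proof -
  define A where "A = 2 * deriv G (rho_bar \<rho> F) * ((deriv ^^ 2) \<rho> F + 4 * (deriv ^^ 2) \<rho> (2 * F))
      + (deriv ^^ 2) \<phi> F + 4 * (deriv ^^ 2) \<phi> (2 * F)"
  define c where "c = (deriv ^^ 2) G (rho_bar \<rho> F) * (deriv \<rho> F + 2 * deriv \<rho> (2 * F))\<^sup>2"
  have c: "c \<ge> 0"
    using assms(12) by (simp add: c_def)
  have mesh: "mesh N > 0"
    using \<open>N \<ge> 1\<close> by (simp add: mesh_def)
  have sv: "second_variation (energy_cr \<phi> \<rho> G N) (uniform_deformation N F) u = mesh N *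
      (\<Sum>l = - int N + 1..int N. c * (strain N u l + strain N u (l + 1))\<^sup>2 + A * (strain N u l)\<^sup>2)"
    if "u \<in> displacements N" for u
    unfolding A_def c_def
    by (rule second_variation_energy_cr) (use assms that in \<open>auto simp: displacements_def\<close>)
  have "stable_cr \<phi> \<rho> G N F \<longleftrightarrow> A > 0"
  proof
    assume stable: "stable_cr \<phi> \<rho> G N F"
    have "alternating 0 \<noteq> 0"
      by (simp add: alternating_def)
    then have "alternating \<noteq> (\<lambda>_. 0)"
      by metis
    with stable have "second_variation (energy_cr \<phi> \<rho> G N) (uniform_deformation N F) alternating > 0"
      using alternating_displacements[OF \<open>N \<ge> 1\<close>] by (simp add: stable_cr_def)
    \<comment> \<open>Consecutive strains cancel, so the \<open>c\<close> term vanishes and only the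
      \<open>A\<close> term remains.\<close>
    then have "0 < A * (\<Sum>l = - int N + 1..int N. (strain N alternating l)\<^sup>2)"
      using mesh sv[OF alternating_displacements[OF \<open>N \<ge> 1\<close>]]
      by (simp add: strain_alternating_Suc zero_less_mult_iff flip: sum_distrib_left)
    \<comment> \<open>This excludes that both factors of the positive product are negative, so the
      sum need not be evaluated.\<close>
    moreover have "(\<Sum>l = - int N + 1..int N. (strain N alternating l)\<^sup>2) \<ge> 0"
      by (simp add: sum_nonneg)
    ultimately show "A > 0"
      by (simp add: zero_less_mult_iff)
  next
    assume A: "A > 0"
    show "stable_cr \<phi> \<rho> G N F"
      unfolding stable_cr_def
    proof
      fix u
      assume "u \<in> displacements N - {\<lambda>_. 0}"
      then have u: "u \<in> displacements N" and "u \<noteq> (\<lambda>_. 0)"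
        by auto
      then obtain l where l: "l \<in> {- int N + 1..int N}" "strain N u l \<noteq> 0"
        using displacements_strain_zero[OF _ \<open>N \<ge> 1\<close>] by blast
      \<comment> \<open>All terms are nonnegative because \<open>c\<close> and \<open>A\<close> are,
        and the term at the chosen site is positive because its strain is nonzero.\<close>
      have "(\<Sum>l = - int N + 1..int N.
          c * (strain N u l + strain N u (l + 1))\<^sup>2 + A * (strain N u l)\<^sup>2) > 0"
        by (rule sum_pos2[OF _ l(1)])
           (use A c l(2) in \<open>auto intro!: add_nonneg_pos add_nonneg_nonneg\<close>)
      then show "second_variation (energy_cr \<phi> \<rho> G N) (uniform_deformation N F) u > 0"
        using mesh by (simp add: sv[OF u])
    qed
  qed
  then show ?thesis
    by (simp add: A_def)
qed

end
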